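(* Let $n\ge 1$ and let $X_1,\dots,X_n$ be independent real-valued random variables with arbitrary (not necessarily identical, not necessarily continuous) distributions. With $s(j,x)$, $v(j,x)$, the thresholds $b_j$ and the set $B$ as defined in the context, the optimal thresholds satisfy $$b_1\le b_2\le\cdots\le b_n=\infty ,$$ and $B$ is a closed (no-exit) set for the running minimum process $(M_j)_{j\le n}$, i.e. if $(j,M_j)\in B$ for some $j<n$ then $(j+1,M_{j+1})\in B$.
   Context: $F_j$ denotes the right-continuous cdf of $X_j$, $F_j(x-)$ its left limit at $x$, and $M_j=\min\{X_1,\dots,X_j\}$. For $1\le j\le n$ and $x\in\mathbb R$ put $$s(j,x):=\prod_{k=j+1}^n\bigl(1-F_k(x-)\bigr),\qquad v(j,x):=\sup_{\tau}\ \mathbb P\bigl(X_\tau\le x,\ X_\tau=\min\{X_{j+1},\dots,X_n\}\bigr),$$ where the supremum is over stopping times $\tau$ of the natural filtration of the observed sequence with $\tau>j$; making no choice is allowed and counts as failure (so the empty product gives $s(n,x)=1$, and $v(n,x)=0$). Here $s(j,x)$ is the probability that stopping at a record $X_j=x$ (a record meaning $X_j=M_j$) is successful, i.e. that $x=M_n$, and $v(j,x)$ is the optimal continuation value when the running minimum after step $j$ is $x$ and stopping continues with later observations. The set $$B:=\{(j,x)\in\{1,\dots,n\}\times\mathbb R:\ s(j,x)\ge v(j,x)\}$$ is the stopping domain: $\min\{j\le n: X_j=M_j,\ (j,X_j)\in B\}$ (with $\min\varnothing=n$) is an optimal stopping time for maximising $\mathbb P(X_\tau=M_n)$. Since $s(j,\cdot)$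 is nonincreasing and $v(j,\cdot)$ is nondecreasing, there is a (finite or infinite) threshold $b_j$ such that $s(j,x)\ge v(j,x)$ for $x<b_j$ and $s(j,x)<v(j,x)$ for $x>b_j$. *)

theory Defs
  imports "HOL-Probability.Probability"
begin

text \<open>
  The observed sequence is X 1, ..., X n on a probability space M; values of X outside
  the index set {1..n} play no role.
\<close>

definition nat_filtration ::
  "'a measure \<Rightarrow> (nat \<Rightarrow> 'a \<Rightarrow> real) \<Rightarrow> nat \<Rightarrow> nat \<Rightarrow> 'a measure" where
  "nat_filtration M X n t =
     sigma (space M) {X i -` A \<inter> space M | i A. i \<in> {1..min t n} \<and> A \<in> sets borel}"

definition running_min :: "(nat \<Rightarrow> 'a \<Rightarrow> real) \<Rightarrow> nat \<Rightarrow> 'a \<Rightarrow> real" where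
  "running_min X j \<omega> = Min ((\<lambda>i. X i \<omega>) ` {1..j})"

text \<open>\<open>Lim (at_left x)\<close> of the cdf is the left limit F(x-).\<close>

definition stop_value ::
  "'a measure \<Rightarrow> (nat \<Rightarrow> 'a \<Rightarrow> real) \<Rightarrow> nat \<Rightarrow> nat \<Rightarrow> real \<Rightarrow> real" where
  "stop_value M X n j x =
     (\<Prod>k\<in>{j<..n}. 1 - Lim (at_left x) (cdf (distr M borel (X k))))"

text \<open>
  Stopping times after step j; the value \<open>Suc n\<close> means that no choice is made. As the
  filtration is constant from time n on, this is the same as admitting the value infinity.
\<close>

definition stopping_rules ::
  "'a measure \<Rightarrow> (nat \<Rightarrow> 'a \<Rightarrow> real) \<Rightarrow> nat \<Rightarrow> nat \<Rightarrow> ('a \<Rightarrow> nat) set" where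
  "stopping_rules M X n j =
     {\<tau>. stopping_time (nat_filtration M X n) \<tau> \<and> (\<forall>\<omega>\<in>space M. \<tau> \<omega> \<in> {j<..Suc n})}"

definition success ::
  "'a measure \<Rightarrow> (nat \<Rightarrow> 'a \<Rightarrow> real) \<Rightarrow> nat \<Rightarrow> nat \<Rightarrow> real \<Rightarrow> ('a \<Rightarrow> nat) \<Rightarrow> 'a set" where
  "success M X n j x \<tau> =
     {\<omega> \<in> space M. \<tau> \<omega> \<le> n \<and> X (\<tau> \<omega>) \<omega> \<le> x \<and>
                    X (\<tau> \<omega>) \<omega> = Min ((\<lambda>i. X i \<omega>) ` {j<..n})}"

definition cont_value ::
  "'a measure \<Rightarrow> (nat \<Rightarrow> 'a \<Rightarrow> real) \<Rightarrow> nat \<Rightarrow> nat \<Rightarrow> real \<Rightarrow> real" where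
  "cont_value M X n j x = (SUP \<tau>\<in>stopping_rules M X n j. measure M (success M X n j x \<tau>))"

definition stopping_domain ::
  "'a measure \<Rightarrow> (nat \<Rightarrow> 'a \<Rightarrow> real) \<Rightarrow> nat \<Rightarrow> (nat \<times> real) set" where
  "stopping_domain M X n =
     {(j, x). j \<in> {1..n} \<and> stop_value M X n j x \<ge> cont_value M X n j x}"

definition is_threshold ::
  "'a measure \<Rightarrow> (nat \<Rightarrow> 'a \<Rightarrow> real) \<Rightarrow> nat \<Rightarrow> nat \<Rightarrow> ereal \<Rightarrow> bool" where
  "is_threshold M X n j b \<longleftrightarrow>
     (\<forall>x::real. ereal x < b \<longrightarrow> stop_value M X n j x \<ge> cont_value M X n j x) \<and>
     (\<forall>x::real. ereal x > b \<longrightarrow> stop_value M X n j x < cont_value M X n j x)"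

text \<open>
  Existence and uniqueness of the threshold are proved below, so that the definite
  description denotes.
\<close>

definition threshold ::
  "'a measure \<Rightarrow> (nat \<Rightarrow> 'a \<Rightarrow> real) \<Rightarrow> nat \<Rightarrow> nat \<Rightarrow> ereal" where
  "threshold M X n j = (THE b. is_threshold M X n j b)"

lemma is_threshold_unique:
  assumes "is_threshold M X n j b" "is_threshold M X n j c"
  shows "b = c"
proof -
  have "\<not> b < c" if "is_threshold M X n j b" "is_threshold M X n j c" for b c
  proof
    assume "b < c"
    then obtain x :: real where "b < ereal x" "ereal x < c"
      using ereal_dense2 by blast
    then show False using that unfolding is_threshold_def by force
  qed
  then show ?thesis using assms by (meson linorder_neqE)
qed

context prob_space
begin

lemma Lim_cdf_at_left:
  assumes "X \<in> borel_measurable M"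
  shows "Lim (at_left x) (cdf (distr M borel X)) = prob {\<omega> \<in> space M. X \<omega> < x}"
proof -
  interpret D: real_distribution "distr M borel X"
    using assms by simp
  have "Lim (at_left x) (cdf (distr M borel X)) = measure (distr M borel X) {..<x}"
    by (intro tendsto_Lim D.cdf_at_left) simp
  also have "\<dots> = prob (X -` {..<x} \<inter> space M)"
    using assms by (simp add: measure_distr)
  also have "X -` {..<x} \<inter> space M = {\<omega> \<in> space M. X \<omega> < x}" by auto
  finally show ?thesis .
qed

lemma stop_value_antimono:
  assumes X: "\<And>i. i \<in> {1..n} \<Longrightarrow> X i \<in> borel_measurable M" and "x \<le> y"
  shows "stop_value M X n j y \<le> stop_value M X n j x"
  unfolding stop_value_def
proof (intro prod_mono conjI)
  fix k assume "k \<in> {j<..n}"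
  then have [measurable]: "X k \<in> borel_measurable M" using X by auto
  show "0 \<le> 1 - Lim (at_left y) (cdf (distr M borel (X k)))"
    by (simp add: Lim_cdf_at_left)
  show "1 - Lim (at_left y) (cdf (distr M borel (X k)))
      \<le> 1 - Lim (at_left x) (cdf (distr M borel (X k)))"
    using \<open>x \<le> y\<close> by (auto simp: Lim_cdf_at_left intro!: finite_measure_mono)
qed

lemma sets_nat_filtration:
  assumes X: "\<And>i. i \<in> {1..n} \<Longrightarrow> X i \<in> borel_measurable M"
  shows "sets (nat_filtration M X n t) \<subseteq> sets M"
proof -
  let ?G = "{X i -` A \<inter> space M | i A. i \<in> {1..min t n} \<and> A \<in> sets borel}"
  have "?G \<subseteq> sets M"
  proof
    fix S assume "S \<in> ?G"
    then obtain i A where S: "S = X i -` A \<inter> space M" "i \<in> {1..n}" "A \<in> sets borel"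
      by auto
    show "S \<in> sets M"
      unfolding S(1) by (rule measurable_sets[OF X[OF S(2)] S(3)])
  qed
  then have "sigma_sets (space M) ?G \<subseteq> sets M"
    by (rule sets.sigma_sets_subset)
  moreover have "?G \<subseteq> Pow (space M)" by blast
  ultimately show ?thesis
    unfolding nat_filtration_def by (simp only: sets_measure_of)
qed

lemma success_in_sets:
  assumes X: "\<And>i. i \<in> {1..n} \<Longrightarrow> X i \<in> borel_measurable M"
    and tau: "\<tau> \<in> stopping_rules M X n j"
  shows "success M X n j x \<tau> \<in> sets M"
proof -
  have sp: "space (nat_filtration M X n t) = space M" for t
    unfolding nat_filtration_def by (rule space_measure_of) auto
  have le: "{\<omega> \<in> space M. \<tau> \<omega> \<le> t} \<in> sets M" for t
  proof -
    have "stopping_time (nat_filtration M X n) \<tau>"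
      using tau unfolding stopping_rules_def by blast
    from stopping_timeD[OF this, of t]
    have "{\<omega> \<in> space M. \<tau> \<omega> \<le> t} \<in> sets (nat_filtration M X n t)"
      unfolding pred_def sp .
    then show ?thesis using sets_nat_filtration[of n X t] X by blast
  qed
  have eq: "{\<omega> \<in> space M. \<tau> \<omega> = k} \<in> sets M" if "k > 0" for k
  proof -
    have "{\<omega> \<in> space M. \<tau> \<omega> = k} = {\<omega> \<in> space M. \<tau> \<omega> \<le> k} - {\<omega> \<in> space M. \<tau> \<omega> \<le> k - 1}"
      using that by auto
    then show ?thesis using le by auto
  qed
  have min: "{\<omega> \<in> space M. X k \<omega> \<le> x \<and> (\<forall>i\<in>{j<..n}. X k \<omega> \<le> X i \<omega>)} \<in> sets M"
    if "k \<in> {j<..n}" for k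
  proof -
    have [measurable]: "X i \<in> borel_measurable M" if "i \<in> {j<..n}" for i
      using X that by auto
    have [measurable]: "X k \<in> borel_measurable M" using X that by auto
    show ?thesis by measurable
  qed
  have "success M X n j x \<tau> = (\<Union>k\<in>{j<..n}. {\<omega> \<in> space M. \<tau> \<omega> = k} \<inter>
      {\<omega> \<in> space M. X k \<omega> \<le> x \<and> (\<forall>i\<in>{j<..n}. X k \<omega> \<le> X i \<omega>)})" (is "?L = ?R")
  proof (intro set_eqI iffI)
    fix \<omega> assume a: "\<omega> \<in> ?L"
    then have "\<tau> \<omega> \<in> {j<..n}"
      using tau by (auto simp: success_def stopping_rules_def)
    with a show "\<omega> \<in> ?R" by (auto simp: success_def)
  next
    fix \<omega> assume "\<omega> \<in> ?R"
    then obtain k where k: "\<omega> \<in> space M" "\<tau> \<omega> = k" "k \<in> {j<..n}" "X k \<omega> \<le> x"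
      "\<forall>i\<in>{j<..n}. X k \<omega> \<le> X i \<omega>" by blast
    then have "X k \<omega> = Min ((\<lambda>i. X i \<omega>) ` {j<..n})"
      by (intro Min_eqI[symmetric]) auto
    with k show "\<omega> \<in> ?L" by (auto simp: success_def)
  qed
  then show ?thesis
    using eq min by (auto intro!: sets.finite_UN)
qed

lemma stopping_rules_nonempty: "j \<le> n \<Longrightarrow> stopping_rules M X n j \<noteq> {}"
  using stopping_time_const[of "nat_filtration M X n" "Suc n"]
  by (auto simp: stopping_rules_def)

lemma cont_value_mono:
  assumes X: "\<And>i. i \<in> {1..n} \<Longrightarrow> X i \<in> borel_measurable M" and "j \<le> n" "x \<le> y"
  shows "cont_value M X n j x \<le> cont_value M X n j y"
  unfolding cont_value_def
proof (rule cSUP_mono[OF stopping_rules_nonempty[OF \<open>j \<le> n\<close>]])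
  show "bdd_above ((\<lambda>\<tau>. prob (success M X n j y \<tau>)) ` stopping_rules M X n j)"
    by (intro bdd_aboveI[of _ 1]) auto
  fix \<tau> assume "\<tau> \<in> stopping_rules M X n j"
  then show "\<exists>\<sigma>\<in>stopping_rules M X n j.
      prob (success M X n j x \<tau>) \<le> prob (success M X n j y \<sigma>)"
    using \<open>x \<le> y\<close> success_in_sets[of n X, OF X]
    by (intro bexI[of _ \<tau>] finite_measure_mono) (auto simp: success_def)
qed

lemma is_threshold_threshold:
  assumes X: "\<And>i. i \<in> {1..n} \<Longrightarrow> X i \<in> borel_measurable M" and "j \<le> n"
  shows "is_threshold M X n j (threshold M X n j)"
proof -
  let ?P = "\<lambda>x. stop_value M X n j x \<ge> cont_value M X n j x"
  define b where "b = (SUP x\<in>{x. ?P x}. ereal x)"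
  have down: "?P x" if "?P y" "x \<le> y" for x y
    using that stop_value_antimono[of n X x y j, OF X] cont_value_mono[of n X j x y, OF X \<open>j \<le> n\<close>]
    by auto
  have "is_threshold M X n j b"
    unfolding is_threshold_def
  proof (intro conjI allI impI)
    fix x :: real assume "ereal x < b"
    then obtain y where "?P y" "x < y" by (auto simp: b_def less_SUP_iff)
    then show "?P x" using down by auto
  next
    fix x :: real assume *: "b < ereal x"
    have "\<not> ?P x"
    proof
      assume "?P x"
      then have "ereal x \<le> b" unfolding b_def by (intro SUP_upper) auto
      with * show False by simp
    qed
    then show "stop_value M X n j x < cont_value M X n j x" by simp
  qed
  then show ?thesis
    unfolding threshold_def by (rule theI) (rule is_threshold_unique[OF _ \<open>is_threshold M X n j b\<close>])
qed

end

end

theory Submission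
  imports Defs
begin

text \<open>
  Everything follows from one implication at a fixed level: if stopping is optimal at
  \<open>(j, x)\<close>, it is optimal at \<open>(j + 1, x)\<close>. As stopping becomes more attractive when \<open>x\<close>
  decreases, this gives the monotonicity of the thresholds, and, as the running minimum never
  increases, that the stopping domain cannot be left. At \<open>j = n\<close> continuing never succeeds, so
  every real level lies in the domain.

  Write \<open>q = P(X\<^bsub>j+1\<^esub> \<ge> x)\<close>, \<open>s\<close> for the stopping value and \<open>v\<close> for the continuation value.
  Then \<open>s(j, x) = q * s(j + 1, x)\<close> by definition, and \<open>v(j, x) \<ge> q * v(j + 1, x)\<close>: pass over
  \<open>X\<^bsub>j+1\<^esub>\<close> and play for the level \<open>x\<close> among the later observations; if \<open>X\<^bsub>j+1\<^esub> \<ge> x\<close>, which is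
  independent of the later observations, a success there is also a success from time \<open>j\<close> on
  (\<open>cont_value_Suc_le\<close>). For \<open>q > 0\<close> one divides \<open>q * v(j + 1, x) \<le> v(j, x) \<le> s(j, x) =
  q * s(j + 1, x)\<close> by \<open>q\<close>. If \<open>q = 0\<close>, then \<open>s(j, x) = 0\<close>, whereas \<open>X\<^bsub>j+1\<^esub> < x\<close> almost surely
  makes \<open>v(j, x) > 0\<close> (\<open>cont_value_pos\<close>), so \<open>(j, x)\<close> is not in the domain at all.

  The delicate point is the independence claim: a rule that stops after time \<open>j + 1\<close> may use
  \<open>X\<^bsub>1\<^esub>, \<dots>, X\<^bsub>j+1\<^esub>\<close>, so its success need not be independent of \<open>X\<^bsub>j+1\<^esub>\<close>. By Fubini, some
  fixed values \<open>y\<^bsub>1\<^esub>, \<dots>, y\<^bsub>j+1\<^esub>\<close> of the past yield a conditional success probability that is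
  at least the overall one, and the rule that plays as if the past had been \<open>y\<close> depends on the
  later observations only (\<open>freeze_past\<close>).
\<close>

section \<open>Sections of events under independence\<close>

context prob_space
begin

text \<open>
  By independence and Fubini, the left-hand side is the mean of the right-hand side over the
  law of \<open>Y\<close>, and a mean cannot exceed all values of the integrand.
\<close>

lemma exists_section_prob_ge:
  assumes ind: "indep_var S Y T Z" and E: "E \<in> sets (S \<Otimes>\<^sub>M T)"
  shows "\<exists>y\<in>space S. prob {\<omega> \<in> space M. (Y \<omega>, Z \<omega>) \<in> E} \<le> prob {\<omega> \<in> space M. (y, Z \<omega>) \<in> E}"
proof (rule ccontr)
  have Y [measurable]: "Y \<in> measurable M S" and Z [measurable]: "Z \<in> measurable M T"
    using indep_var_rv1[OF ind] indep_var_rv2[OF ind] .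
  interpret DY: prob_space "distr M S Y" by (rule prob_space_distr) fact
  interpret DZ: prob_space "distr M T Z" by (rule prob_space_distr) fact
  let ?c = "prob {\<omega> \<in> space M. (Y \<omega>, Z \<omega>) \<in> E}"
  let ?g = "\<lambda>y. prob {\<omega> \<in> space M. (y, Z \<omega>) \<in> E}"
  have sec: "Pair y -` E \<in> sets T" for y
    using E by (rule sets_Pair1)
  have g: "?g y = measure (distr M T Z) (Pair y -` E)" for y
    using sec[of y] by (subst measure_distr) (auto intro!: arg_cong[where f=prob])
  have E': "E \<in> sets (distr M S Y \<Otimes>\<^sub>M distr M T Z)"
    using E by (simp cong: sets_pair_measure_cong)
  have meas: "(\<lambda>y. emeasure (distr M T Z) (Pair y -` E)) \<in> borel_measurable (distr M S Y)"
    using DZ.measurable_emeasure_Pair[OF E'] .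
  then have "(\<lambda>y. measure (distr M T Z) (Pair y -` E)) \<in> borel_measurable (distr M S Y)"
    unfolding measure_def by (rule borel_measurable_enn2real)
  then have gm: "?g \<in> borel_measurable (distr M S Y)"
    unfolding g .
  have int: "integrable (distr M S Y) ?g"
    by (rule DY.integrable_const_bound[where B=1]) (use gm in auto)
  have "ennreal ?c = emeasure (distr M (S \<Otimes>\<^sub>M T) (\<lambda>\<omega>. (Y \<omega>, Z \<omega>))) E"
    using E by (subst emeasure_distr) (auto simp: emeasure_eq_measure intro!: arg_cong[where f=prob])
  also have "\<dots> = emeasure (distr M S Y \<Otimes>\<^sub>M distr M T Z) E"
    using ind by (simp add: indep_var_distribution_eq)
  also have "\<dots> = (\<integral>\<^sup>+y. emeasure (distr M T Z) (Pair y -` E) \<partial>distr M S Y)"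
    by (rule DZ.emeasure_pair_measure_alt[OF E'])
  also have "\<dots> = (\<integral>\<^sup>+y. ennreal (?g y) \<partial>distr M S Y)"
    unfolding g DZ.emeasure_eq_measure ..
  also have "\<dots> = ennreal (DY.expectation ?g)"
    by (intro nn_integral_eq_integral int) simp
  finally have c: "?c = DY.expectation ?g"
    by (simp add: Bochner_Integration.integral_nonneg)
  assume "\<not> (\<exists>y\<in>space S. ?c \<le> ?g y)"
  then have "AE y in distr M S Y. ?g y < ?c"
    by (intro AE_I2) (auto simp: not_le)
  from DY.expectation_less[OF int this] c show False by simp
qed

section \<open>Stopping rules as functions of the observed path\<close>

lemma space_nat_filtration: "space (nat_filtration M X n t) = space M"
  unfolding nat_filtration_def by (rule space_measure_of) auto

lemma measurable_nat_filtration_component: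
  assumes "i \<in> {1..t}" "t \<le> n"
  shows "X i \<in> borel_measurable (nat_filtration M X n t)"
proof (rule measurableI)
  fix A :: "real set" assume "A \<in> sets borel"
  then have "X i -` A \<inter> space M \<in> {X i -` A \<inter> space M | i A. i \<in> {1..min t n} \<and> A \<in> sets borel}"
    using assms by auto
  then show "X i -` A \<inter> space (nat_filtration M X n t) \<in> sets (nat_filtration M X n t)"
    unfolding space_nat_filtration unfolding nat_filtration_def
    by (subst sets_measure_of) (auto intro: sigma_sets.Basic)
qed auto

text \<open>
  Writing the events \<open>\<tau> \<le> k\<close> as conditions on the path up to time \<open>k\<close> makes it possible to
  evaluate a stopping rule along a path other than the observed one.
\<close>

lemma nat_filtration_event_factors:
  assumes "t \<le> n" "S \<in> sets (nat_filtration M X n t)"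
  shows "\<exists>A\<in>sets (PiM {1..t} (\<lambda>_. borel)). S = {\<omega> \<in> space M. (\<lambda>i\<in>{1..t}. X i \<omega>) \<in> A}"
proof -
  \<comment> \<open>Every event of \<open>?V\<close> has the required form, so it suffices to find the generators there.\<close>
  let ?V = "vimage_algebra (space M) (\<lambda>\<omega>. \<lambda>i\<in>{1..t}. X i \<omega>) (PiM {1..t} (\<lambda>_. borel))"
  let ?G = "{X i -` A \<inter> space M | i A. i \<in> {1..min t n} \<and> A \<in> sets borel}"
  have path: "(\<lambda>\<omega>. \<lambda>i\<in>{1..t}. X i \<omega>) \<in> measurable ?V (PiM {1..t} (\<lambda>_. borel))"
    by (rule measurable_vimage_algebra1) (auto simp: space_PiM)
  have "?G \<subseteq> sets ?V"
  proof safe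
    fix i and A :: "real set" assume iA: "i \<in> {1..min t n}" "A \<in> sets borel"
    then have "(\<lambda>\<omega>. (\<lambda>i\<in>{1..t}. X i \<omega>) i) \<in> borel_measurable ?V"
      by (intro measurable_compose[OF path] measurable_component_singleton) auto
    from measurable_sets[OF this iA(2)] show "X i -` A \<inter> space M \<in> sets ?V"
      using iA(1) by simp
  qed
  then have "sigma_sets (space M) ?G \<subseteq> sets ?V"
    using sets.sigma_sets_subset[of ?G ?V] by simp
  moreover have "S \<in> sigma_sets (space M) ?G"
    using assms(2) unfolding nat_filtration_def by (subst (asm) sets_measure_of) auto
  ultimately have "S \<in> sets ?V" by blast
  then obtain A where "A \<in> sets (PiM {1..t} (\<lambda>_. borel))"
    "S = (\<lambda>\<omega>. \<lambda>i\<in>{1..t}. X i \<omega>) -` A \<inter> space M"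
    by (subst (asm) sets_vimage_algebra2) (auto simp: space_PiM)
  then show ?thesis by blast
qed

text \<open>
  Naming the time \<open>k\<close> of success replaces the random index in \<open>X (\<tau> \<omega>) \<omega>\<close>
  by finitely many fixed ones, which is what measurability and substitution arguments need.
\<close>

lemma success_iff:
  assumes "\<tau> \<in> stopping_rules M X n j"
  shows "\<omega> \<in> success M X n j x \<tau> \<longleftrightarrow> \<omega> \<in> space M \<and>
    (\<exists>k\<in>{j<..n}. \<tau> \<omega> = k \<and> X k \<omega> \<le> x \<and> (\<forall>i\<in>{j<..n}. X k \<omega> \<le> X i \<omega>))" (is "_ \<longleftrightarrow> ?R")
proof
  assume a: "\<omega> \<in> success M X n j x \<tau>"
  then have "\<tau> \<omega> \<in> {j<..n}"
    using assms by (auto simp: success_def stopping_rules_def)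
  with a show ?R by (auto simp: success_def)
next
  assume ?R
  then obtain k where k: "\<omega> \<in> space M" "\<tau> \<omega> = k" "k \<in> {j<..n}" "X k \<omega> \<le> x"
    "\<forall>i\<in>{j<..n}. X k \<omega> \<le> X i \<omega>" by blast
  then have "X k \<omega> = Min ((\<lambda>i. X i \<omega>) ` {j<..n})"
    by (intro Min_eqI[symmetric]) auto
  with k show "\<omega> \<in> success M X n j x \<tau>" by (auto simp: success_def)
qed

end

text \<open>
  The rule that stops at the first time \<open>k\<close> after \<open>m\<close> at which the path up to \<open>k\<close> lies
  in \<open>A k\<close>. The disjunct \<open>k = Suc n\<close> encodes that no choice is made; it also ensures that the
  least element exists.
\<close>

definition path_rule :: "(nat \<Rightarrow> (nat \<Rightarrow> real) set) \<Rightarrow> nat \<Rightarrow> nat \<Rightarrow> (nat \<Rightarrow> real) \<Rightarrow> nat" where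
  "path_rule A m n f = (LEAST k. k = Suc n \<or> k \<in> {m<..n} \<and> restrict f {1..k} \<in> A k)"

lemma path_rule_range: "m \<le> n \<Longrightarrow> path_rule A m n f \<in> {m<..Suc n}"
  unfolding path_rule_def
  by (rule LeastI2_wellorder[where a="Suc n"]) auto

lemma path_rule_le_iff:
  assumes "t \<le> n"
  shows "path_rule A m n f \<le> t \<longleftrightarrow> (\<exists>k\<in>{m<..t}. restrict f {1..k} \<in> A k)"
proof
  assume le: "path_rule A m n f \<le> t"
  let ?P = "\<lambda>k. k = Suc n \<or> k \<in> {m<..n} \<and> restrict f {1..k} \<in> A k"
  have "?P (path_rule A m n f)"
    unfolding path_rule_def by (rule LeastI[of ?P "Suc n"]) simp
  then show "\<exists>k\<in>{m<..t}. restrict f {1..k} \<in> A k"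
    using le assms by auto
next
  assume "\<exists>k\<in>{m<..t}. restrict f {1..k} \<in> A k"
  then obtain k where "k \<in> {m<..t}" "restrict f {1..k} \<in> A k" by blast
  then have "path_rule A m n f \<le> k"
    unfolding path_rule_def using assms by (intro Least_le) auto
  with \<open>k \<in> {m<..t}\<close> show "path_rule A m n f \<le> t" by simp
qed

lemma measurable_path_rule:
  assumes "\<And>k. k \<in> {m<..n} \<Longrightarrow> A k \<in> sets (PiM {1..k} (\<lambda>_. borel))"
  shows "path_rule A m n \<in> measurable (PiM {1..n} (\<lambda>_. borel)) (count_space UNIV)"
proof -
  have "(\<lambda>f. k = Suc n \<or> k \<in> {m<..n} \<and> restrict f {1..k} \<in> A k)
      \<in> measurable (PiM {1..n} (\<lambda>_. borel)) (count_space UNIV)" (is "?P \<in> _") for k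
  proof (cases "k \<in> {m<..n}")
    case True
    have [measurable]: "(\<lambda>f. restrict f {1..k})
        \<in> measurable (PiM {1..n} (\<lambda>_. borel)) (PiM {1..k} (\<lambda>_. borel :: real measure))"
      using True by (intro measurable_restrict_subset) auto
    have [measurable]: "A k \<in> sets (PiM {1..k} (\<lambda>_. borel))" using assms True .
    have "?P = (\<lambda>f. restrict f {1..k} \<in> A k)"
      using True by auto
    moreover have "(\<lambda>f. restrict f {1..k} \<in> A k)
        \<in> measurable (PiM {1..n} (\<lambda>_. borel)) (count_space UNIV)"
      by measurable
    ultimately show ?thesis by (simp only:)
  next
    case False
    then have "?P = (\<lambda>_. k = Suc n)" by auto
    then show ?thesis by (simp only: measurable_const space_count_space UNIV_I)
  qed
  then show ?thesis unfolding path_rule_def[abs_def] by (rule measurable_Least)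
qed

context prob_space
begin

section \<open>Freezing the past\<close>

text \<open>
  When playing for the level \<open>x\<close> from time \<open>m\<close> on, the independent past is mere randomisation,
  and replacing it by its most favourable value (or one at least as good as the average) does not
  hurt. The set \<open>D\<close> records that the success of the new rule is decided by the
  observations after \<open>m\<close> alone.
\<close>

lemma freeze_past:
  assumes ind: "indep_vars (\<lambda>_. borel) X {1..n}" and m: "m \<le> n"
    and tau: "\<tau> \<in> stopping_rules M X n m"
  obtains \<sigma> D where "\<sigma> \<in> stopping_rules M X n m" "D \<in> sets (PiM {m<..n} (\<lambda>_. borel))"
    "success M X n m x \<sigma> = {\<omega> \<in> space M. (\<lambda>i\<in>{m<..n}. X i \<omega>) \<in> D}"
    "prob (success M X n m x \<tau>) \<le> prob (success M X n m x \<sigma>)"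
proof -
  let ?B = "\<lambda>I. PiM I (\<lambda>_::nat. borel :: real measure)"
  let ?Y = "\<lambda>\<omega>. \<lambda>i\<in>{1..m}. X i \<omega>" and ?Z = "\<lambda>\<omega>. \<lambda>i\<in>{m<..n}. X i \<omega>"
  have "\<forall>k\<in>{m<..n}. \<exists>A. A \<in> sets (?B {1..k}) \<and>
      {\<omega> \<in> space M. \<tau> \<omega> \<le> k} = {\<omega> \<in> space M. (\<lambda>i\<in>{1..k}. X i \<omega>) \<in> A}"
  proof
    fix k assume k: "k \<in> {m<..n}"
    have "stopping_time (nat_filtration M X n) \<tau>"
      using tau unfolding stopping_rules_def by blast
    from stopping_timeD[OF this, of k]
    have ev: "{\<omega> \<in> space M. \<tau> \<omega> \<le> k} \<in> sets (nat_filtration M X n k)"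
      unfolding pred_def space_nat_filtration .
    have "k \<le> n" using k by simp
    from nat_filtration_event_factors[OF this ev]
    show "\<exists>A. A \<in> sets (?B {1..k}) \<and>
      {\<omega> \<in> space M. \<tau> \<omega> \<le> k} = {\<omega> \<in> space M. (\<lambda>i\<in>{1..k}. X i \<omega>) \<in> A}"
      unfolding Bex_def .
  qed
  from bchoice[OF this] obtain A where AA: "\<forall>k\<in>{m<..n}. A k \<in> sets (?B {1..k}) \<and>
      {\<omega> \<in> space M. \<tau> \<omega> \<le> k} = {\<omega> \<in> space M. (\<lambda>i\<in>{1..k}. X i \<omega>) \<in> A k}" ..
  have A: "A k \<in> sets (?B {1..k})" if "k \<in> {m<..n}" for k
    using AA that by blast
  have tau_A: "{\<omega> \<in> space M. \<tau> \<omega> \<le> k} = {\<omega> \<in> space M. (\<lambda>i\<in>{1..k}. X i \<omega>) \<in> A k}"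
    if "k \<in> {m<..n}" for k
    using bspec[OF AA that] by (rule conjunct2)
  define T where "T = path_rule A m n"
  have T_range: "T f \<in> {m<..Suc n}" for f
    unfolding T_def using m by (rule path_rule_range)
  define W where "W = {f \<in> space (?B {1..n}).
    \<exists>k\<in>{m<..n}. T f = k \<and> f k \<le> x \<and> (\<forall>i\<in>{m<..n}. f k \<le> f i)}"
  have T: "T \<in> measurable (?B {1..n}) (count_space UNIV)"
    unfolding T_def using A by (rule measurable_path_rule)
  have coord: "(\<lambda>f. f i) \<in> borel_measurable (?B {1..n})" if "i \<in> {m<..n}" for i
    using that by (intro measurable_component_singleton) auto
  have W: "W \<in> sets (?B {1..n})"
    unfolding W_def
  proof (intro sets.sets_Collect_finite_Ex sets.sets_Collect_conj sets.sets_Collect_finite_All'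
      finite_greaterThanAtMost borel_measurable_le coord borel_measurable_const)
    fix k
    have "T -` {k} \<inter> space (?B {1..n}) \<in> sets (?B {1..n})"
      using T by (rule measurable_sets) simp
    also have "T -` {k} \<inter> space (?B {1..n}) = {f \<in> space (?B {1..n}). T f = k}" by blast
    finally show "{f \<in> space (?B {1..n}). T f = k} \<in> sets (?B {1..n})" .
  qed auto
  have split: "{1..m} \<union> {m<..n} = {1..n}" using m by auto
  have merge: "merge {1..m} {m<..n} \<in> measurable (?B {1..m} \<Otimes>\<^sub>M ?B {m<..n}) (?B {1..n})"
    using measurable_merge[of "{1..m}" "{m<..n}" "\<lambda>_. borel :: real measure"] by (simp only: split)
  \<comment> \<open>\<open>E\<close> is the success event \<open>W\<close> of the rule, as a set of pairs of past and future.\<close>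
  define E where "E = merge {1..m} {m<..n} -` W \<inter> space (?B {1..m} \<Otimes>\<^sub>M ?B {m<..n})"
  have E: "E \<in> sets (?B {1..m} \<Otimes>\<^sub>M ?B {m<..n})"
    unfolding E_def using merge W by (rule measurable_sets)
  have indYZ: "indep_var (?B {1..m}) ?Y (?B {m<..n}) ?Z"
    using m by (intro indep_var_restrict[OF ind]) auto
  obtain y where y: "y \<in> space (?B {1..m})"
    and y_ge: "prob {\<omega> \<in> space M. (?Y \<omega>, ?Z \<omega>) \<in> E} \<le> prob {\<omega> \<in> space M. (y, ?Z \<omega>) \<in> E}"
    using exists_section_prob_ge[OF indYZ E] by blast
  have in_E: "(u, ?Z \<omega>) \<in> E \<longleftrightarrow> (\<exists>k\<in>{m<..n}. T (merge {1..m} {m<..n} (u, ?Z \<omega>)) = k \<and>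
      X k \<omega> \<le> x \<and> (\<forall>i\<in>{m<..n}. X k \<omega> \<le> X i \<omega>))"
    if u: "u \<in> space (?B {1..m})" for u \<omega>
  proof -
    define f where "f = merge {1..m} {m<..n} (u, ?Z \<omega>)"
    have pair: "(u, ?Z \<omega>) \<in> space (?B {1..m} \<Otimes>\<^sub>M ?B {m<..n})"
      using u by (simp add: space_pair_measure space_PiM)
    have "f \<in> space (?B {1..n})"
      unfolding f_def by (rule measurable_space[OF merge pair])
    then have "f \<in> W \<longleftrightarrow>
        (\<exists>k\<in>{m<..n}. T f = k \<and> f k \<le> x \<and> (\<forall>i\<in>{m<..n}. f k \<le> f i))"
      unfolding W_def by blast
    moreover have "(u, ?Z \<omega>) \<in> E \<longleftrightarrow> f \<in> W"
      by (simp only: E_def Int_iff vimage_eq f_def pair simp_thms)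
    moreover have "f k = X k \<omega>" if "k \<in> {m<..n}" for k
      using that by (auto simp: merge_def f_def)
    then have "(\<exists>k\<in>{m<..n}. T f = k \<and> f k \<le> x \<and> (\<forall>i\<in>{m<..n}. f k \<le> f i)) \<longleftrightarrow>
        (\<exists>k\<in>{m<..n}. T f = k \<and> X k \<omega> \<le> x \<and> (\<forall>i\<in>{m<..n}. X k \<omega> \<le> X i \<omega>))"
      by (intro bex_cong refl) (simp del: greaterThanAtMost_iff cong: ball_cong)
    ultimately show ?thesis
      unfolding f_def[symmetric] by (simp only:)
  qed
  \<comment> \<open>On the path actually observed, \<open>T\<close> recovers the given rule.\<close>
  have T_tau: "T (merge {1..m} {m<..n} (?Y \<omega>, ?Z \<omega>)) = \<tau> \<omega>" if \<omega>: "\<omega> \<in> space M" for \<omega>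
  proof -
    define f where "f = merge {1..m} {m<..n} (?Y \<omega>, ?Z \<omega>)"
    have restr: "restrict f {1..k} = (\<lambda>i\<in>{1..k}. X i \<omega>)" if "k \<le> n" for k
      using that by (auto simp: f_def merge_def fun_eq_iff)
    have t: "\<tau> \<omega> \<in> {m<..Suc n}"
      using tau \<omega> by (auto simp: stopping_rules_def)
    have iff: "restrict f {1..k} \<in> A k \<longleftrightarrow> \<tau> \<omega> \<le> k" if "k \<in> {m<..n}" for k
      using tau_A[OF that] that \<omega> restr[of k] by auto
    have "T f = (LEAST k. k = Suc n \<or> k \<in> {m<..n} \<and> \<tau> \<omega> \<le> k)"
      unfolding T_def path_rule_def by (intro arg_cong[where f=Least] ext) (use iff in blast)
    also have "\<dots> = \<tau> \<omega>"
      using t by (intro Least_equality) auto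
    finally show ?thesis unfolding f_def .
  qed
  define \<sigma> where "\<sigma> \<omega> = T (merge {1..m} {m<..n} (y, ?Z \<omega>))" for \<omega>
  have sigma: "\<sigma> \<in> stopping_rules M X n m"
    unfolding stopping_rules_def
  proof (intro CollectI conjI ballI)
    fix \<omega> show "\<sigma> \<omega> \<in> {m<..Suc n}" unfolding \<sigma>_def by (rule T_range)
  next
    show "stopping_time (nat_filtration M X n) \<sigma>"
      unfolding stopping_time_def
    proof
      fix t
      show "Measurable.pred (nat_filtration M X n t) (\<lambda>\<omega>. \<sigma> \<omega> \<le> t)"
      proof (cases "t \<le> n")
        case True
        have [measurable]: "(\<lambda>\<omega>. restrict (merge {1..m} {m<..n} (y, ?Z \<omega>)) {1..k})
            \<in> measurable (nat_filtration M X n t) (?B {1..k})" if k: "k \<in> {m<..t}" for k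
        proof (rule measurable_restrict)
          fix i assume i: "i \<in> {1..k}"
          show "(\<lambda>\<omega>. merge {1..m} {m<..n} (y, ?Z \<omega>) i) \<in> borel_measurable (nat_filtration M X n t)"
          \<comment> \<open>The coordinates up to \<open>m\<close> are constants taken from \<open>y\<close>, the others are observed by time \<open>t\<close>.\<close>
          proof (cases "i \<le> m")
            case True
            with i show ?thesis by (simp add: merge_def)
          next
            case False
            with i k \<open>t \<le> n\<close> measurable_nat_filtration_component[of i t n X]
            show ?thesis by (simp add: merge_def)
          qed
        qed
        have [measurable]: "A k \<in> sets (?B {1..k})" if "k \<in> {m<..t}" for k
          using A that True by auto
        show ?thesis
          unfolding \<sigma>_def T_def path_rule_le_iff[OF True] by measurable
      next
        case False
        then have "\<sigma> \<omega> \<le> t" for \<omega>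
          using T_range[of "merge {1..m} {m<..n} (y, ?Z \<omega>)"] by (auto simp: \<sigma>_def)
        then show ?thesis by simp
      qed
    qed
  qed
  have succ_sigma: "success M X n m x \<sigma> = {\<omega> \<in> space M. (y, ?Z \<omega>) \<in> E}"
    using in_E[OF y] by (auto simp: success_iff[OF sigma] \<sigma>_def)
  have succ_tau: "success M X n m x \<tau> = {\<omega> \<in> space M. (?Y \<omega>, ?Z \<omega>) \<in> E}"
  proof -
    have "?Y \<omega> \<in> space (?B {1..m})" for \<omega> by (simp add: space_PiM)
    from in_E[OF this] show ?thesis
      using T_tau by (auto simp: success_iff[OF tau])
  qed
  show thesis
  proof
    show "\<sigma> \<in> stopping_rules M X n m" by fact
    show "Pair y -` E \<in> sets (?B {m<..n})" using E by (rule sets_Pair1)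
    show "success M X n m x \<sigma> = {\<omega> \<in> space M. ?Z \<omega> \<in> Pair y -` E}"
      unfolding succ_sigma by simp
    show "prob (success M X n m x \<tau>) \<le> prob (success M X n m x \<sigma>)"
      unfolding succ_sigma succ_tau by (rule y_ge)
  qed
qed

section \<open>Lower bounds for the continuation value\<close>

lemma prob_success_le_cont_value:
  assumes "\<tau> \<in> stopping_rules M X n j"
  shows "prob (success M X n j x \<tau>) \<le> cont_value M X n j x"
  unfolding cont_value_def by (rule cSUP_upper[OF assms]) (auto intro: bdd_aboveI[of _ 1])

text \<open>
  The next observation is passed over. A success at level \<open>x\<close> among the observations after
  \<open>Suc j\<close> has a value of at most \<open>x\<close>, so an observation \<open>X (Suc j) \<ge> x\<close> does not spoil it; with
  a rule from \<open>freeze_past\<close> the two events are independent.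
\<close>

lemma cont_value_Suc_le:
  assumes ind: "indep_vars (\<lambda>_. borel) X {1..n}" and j: "Suc j \<le> n"
  shows "prob {\<omega> \<in> space M. x \<le> X (Suc j) \<omega>} * cont_value M X n (Suc j) x \<le> cont_value M X n j x"
proof -
  let ?q = "prob {\<omega> \<in> space M. x \<le> X (Suc j) \<omega>}"
  let ?m = "Suc j"
  have X: "\<And>i. i \<in> {1..n} \<Longrightarrow> X i \<in> borel_measurable M"
    using ind by (auto simp: indep_vars_def2)
  have le: "?q * prob (success M X n ?m x \<tau>) \<le> cont_value M X n j x"
    if tau: "\<tau> \<in> stopping_rules M X n ?m" for \<tau>
  proof -
    let ?Y = "\<lambda>\<omega>. \<lambda>i\<in>{?m}. X i \<omega>" and ?Z = "\<lambda>\<omega>. \<lambda>i\<in>{?m<..n}. X i \<omega>"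
    let ?C = "{f \<in> space (PiM {?m} (\<lambda>_. borel)). x \<le> f ?m}"
    obtain \<sigma> D where sigma: "\<sigma> \<in> stopping_rules M X n ?m"
      and D: "D \<in> sets (PiM {?m<..n} (\<lambda>_. borel))"
      and succ: "success M X n ?m x \<sigma> = {\<omega> \<in> space M. ?Z \<omega> \<in> D}"
      and ge: "prob (success M X n ?m x \<tau>) \<le> prob (success M X n ?m x \<sigma>)"
      using freeze_past[OF ind j tau] by blast
    have sigma': "\<sigma> \<in> stopping_rules M X n j"
      using sigma by (fastforce simp: stopping_rules_def)
    have indYZ: "indep_var (PiM {?m} (\<lambda>_. borel)) ?Y (PiM {?m<..n} (\<lambda>_. borel)) ?Z"
      using j by (intro indep_var_restrict[OF ind]) auto
    have C: "?C \<in> sets (PiM {?m} (\<lambda>_. borel))" by measurable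
    have "?q * prob (success M X n ?m x \<tau>) \<le> ?q * prob (success M X n ?m x \<sigma>)"
      using ge by (intro mult_left_mono) auto
    also have "\<dots> = prob (?Y -` ?C \<inter> space M) * prob (?Z -` D \<inter> space M)"
      unfolding succ by (auto intro!: arg_cong2[where f="(*)"] arg_cong[where f=prob] simp: space_PiM)
    also have "\<dots> = prob ((\<lambda>\<omega>. (?Y \<omega>, ?Z \<omega>)) -` (?C \<times> D) \<inter> space M)"
      using indep_varD[OF indYZ C D] by simp
    also have "\<dots> \<le> prob (success M X n j x \<sigma>)"
    proof (rule finite_measure_mono)
      show "success M X n j x \<sigma> \<in> events"
        using X sigma' by (rule success_in_sets)
      show "(\<lambda>\<omega>. (?Y \<omega>, ?Z \<omega>)) -` (?C \<times> D) \<inter> space M \<subseteq> success M X n j x \<sigma>"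
      proof
        fix \<omega> assume \<omega>: "\<omega> \<in> (\<lambda>\<omega>. (?Y \<omega>, ?Z \<omega>)) -` (?C \<times> D) \<inter> space M"
        then have "\<omega> \<in> success M X n ?m x \<sigma>" and x: "x \<le> X ?m \<omega>"
          unfolding succ by auto
        then obtain k where k: "\<omega> \<in> space M" "k \<in> {?m<..n}" "\<sigma> \<omega> = k" "X k \<omega> \<le> x"
          "\<forall>i\<in>{?m<..n}. X k \<omega> \<le> X i \<omega>"
          by (auto simp: success_iff[OF sigma])
        moreover have "{j<..n} = insert ?m {?m<..n}" using j by auto
        ultimately show "\<omega> \<in> success M X n j x \<sigma>"
          using x by (auto simp: success_iff[OF sigma'])
      qed
    qed
    also have "\<dots> \<le> cont_value M X n j x"
      using sigma' by (rule prob_success_le_cont_value)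
    finally show ?thesis .
  qed
  show ?thesis
  proof (cases "?q = 0")
    case True
    obtain \<tau> where "\<tau> \<in> stopping_rules M X n ?m"
      using stopping_rules_nonempty[OF j] by blast
    from le[OF this] True show ?thesis by simp
  next
    case False
    then have q: "?q > 0" by (simp add: zero_less_measure_iff)
    have "cont_value M X n ?m x \<le> cont_value M X n j x / ?q"
      unfolding cont_value_def[of M X n ?m]
      using le q by (intro cSUP_least stopping_rules_nonempty j) (simp add: field_simps)
    with q show ?thesis by (simp add: field_simps)
  qed
qed

text \<open>
  When \<open>X (Suc j) < x\<close>, the minimum of the remaining observations is below \<open>x\<close> too, and it is
  attained at one of finitely many times. Hence some rule that stops at a fixed time succeeds with positive
  probability.
\<close>

lemma cont_value_pos:
  assumes X: "\<And>i. i \<in> {1..n} \<Longrightarrow> X i \<in> borel_measurable M" and j: "Suc j \<le> n"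
    and pos: "prob {\<omega> \<in> space M. X (Suc j) \<omega> < x} > 0"
  shows "cont_value M X n j x > 0"
proof (rule ccontr)
  assume not: "\<not> cont_value M X n j x > 0"
  have rule: "(\<lambda>_. k) \<in> stopping_rules M X n j" if "k \<in> {j<..n}" for k
    using that stopping_time_const[of "nat_filtration M X n" k] by (auto simp: stopping_rules_def)
  have "{\<omega> \<in> space M. X (Suc j) \<omega> < x} \<subseteq> (\<Union>k\<in>{j<..n}. success M X n j x (\<lambda>_. k))"
  proof
    fix \<omega> assume \<omega>: "\<omega> \<in> {\<omega> \<in> space M. X (Suc j) \<omega> < x}"
    have "finite {j<..n}" "{j<..n} \<noteq> {}" using j by auto
    then obtain k where k: "k \<in> {j<..n}" "\<forall>i\<in>{j<..n}. X k \<omega> \<le> X i \<omega>"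
      using ex_min_if_finite[of "(\<lambda>i. X i \<omega>) ` {j<..n}"] by (force simp: not_less)
    have "X k \<omega> \<le> X (Suc j) \<omega>" using k j by auto
    then have "X k \<omega> \<le> x" using \<omega> by auto
    with \<omega> k show "\<omega> \<in> (\<Union>k\<in>{j<..n}. success M X n j x (\<lambda>_. k))"
      by (auto simp: success_iff[OF rule] intro!: bexI[of _ k])
  qed
  then have "prob {\<omega> \<in> space M. X (Suc j) \<omega> < x}
      \<le> prob (\<Union>k\<in>{j<..n}. success M X n j x (\<lambda>_. k))"
    using success_in_sets[of n X, OF X rule] by (intro finite_measure_mono) auto
  also have "\<dots> \<le> (\<Sum>k\<in>{j<..n}. prob (success M X n j x (\<lambda>_. k)))"
    using success_in_sets[of n X, OF X rule] by (intro finite_measure_subadditive_finite) auto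
  also have "\<dots> \<le> 0"
    using prob_success_le_cont_value[OF rule] not by (intro sum_nonpos) (meson not_less order_trans)
  finally show False using pos by simp
qed

section \<open>Monotonicity of the stopping domain\<close>

lemma stop_value_Suc:
  assumes "Suc j \<le> n" and [measurable]: "X (Suc j) \<in> borel_measurable M"
  shows "stop_value M X n j x = prob {\<omega> \<in> space M. x \<le> X (Suc j) \<omega>} * stop_value M X n (Suc j) x"
proof -
  have "prob {\<omega> \<in> space M. x \<le> X (Suc j) \<omega>} = 1 - prob {\<omega> \<in> space M. X (Suc j) \<omega> < x}"
    using prob_neg[of "\<lambda>\<omega>. X (Suc j) \<omega> < x"] by (simp add: not_less)
  moreover have "{j<..n} = insert (Suc j) {Suc j<..n}" using assms by auto
  ultimately show ?thesis
    by (simp add: stop_value_def Lim_cdf_at_left)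
qed

text \<open>
  Passing from \<open>j\<close> to \<open>Suc j\<close> divides the stopping value by \<open>q = P(X (Suc j) \<ge> x)\<close> and multiplies
  the continuation value by at most \<open>1 / q\<close>, so the comparison between them persists. The
  degenerate case \<open>q = 0\<close> contradicts the hypothesis.
\<close>

lemma stopping_domain_Suc:
  assumes ind: "indep_vars (\<lambda>_. borel) X {1..n}" and j: "Suc j \<le> n"
    and stop: "cont_value M X n j x \<le> stop_value M X n j x"
  shows "cont_value M X n (Suc j) x \<le> stop_value M X n (Suc j) x"
proof -
  let ?q = "prob {\<omega> \<in> space M. x \<le> X (Suc j) \<omega>}"
  have X: "\<And>i. i \<in> {1..n} \<Longrightarrow> X i \<in> borel_measurable M"
    using ind by (auto simp: indep_vars_def2)
  have [measurable]: "X (Suc j) \<in> borel_measurable M" using X j by auto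
  have s: "stop_value M X n j x = ?q * stop_value M X n (Suc j) x"
    using j by (intro stop_value_Suc) auto
  have "?q \<noteq> 0"
  proof
    assume q: "?q = 0"
    then have "prob {\<omega> \<in> space M. X (Suc j) \<omega> < x} = 1"
      using prob_neg[of "\<lambda>\<omega>. X (Suc j) \<omega> < x"] by (simp add: not_less)
    then have "cont_value M X n j x > 0"
      using cont_value_pos[of n X, OF X j, of x] by simp
    with stop s q show False by simp
  qed
  then have "?q > 0" by (simp add: zero_less_measure_iff)
  moreover have "?q * cont_value M X n (Suc j) x \<le> ?q * stop_value M X n (Suc j) x"
    using cont_value_Suc_le[OF ind j, of x] stop s by simp
  ultimately show ?thesis by simp
qed

lemma threshold_mono_Suc:
  assumes ind: "indep_vars (\<lambda>_. borel) X {1..n}" and j: "Suc j \<le> n"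
  shows "threshold M X n j \<le> threshold M X n (Suc j)"
proof (rule ccontr)
  have X: "\<And>i. i \<in> {1..n} \<Longrightarrow> X i \<in> borel_measurable M"
    using ind by (auto simp: indep_vars_def2)
  have b: "is_threshold M X n j (threshold M X n j)"
    "is_threshold M X n (Suc j) (threshold M X n (Suc j))"
    using is_threshold_threshold[of n X, OF X] j by auto
  assume "\<not> ?thesis"
  then obtain x where "threshold M X n (Suc j) < ereal x" "ereal x < threshold M X n j"
    using ereal_dense2[of "threshold M X n (Suc j)" "threshold M X n j"] by (auto simp: not_le)
  with b stopping_domain_Suc[OF ind j, of x] show False
    unfolding is_threshold_def by force
qed

lemma threshold_last: "threshold M X n n = \<infinity>"
proof -
  have empty: "success M X n n x \<tau> = {}" if "\<tau> \<in> stopping_rules M X n n" for x \<tau>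
    using that by (auto simp: success_def stopping_rules_def)
  have "cont_value M X n n x = 0" for x
    unfolding cont_value_def using stopping_rules_nonempty[of n n X] by (simp add: empty)
  then have "is_threshold M X n n \<infinity>"
    by (simp add: is_threshold_def stop_value_def)
  then show ?thesis
    unfolding threshold_def by (intro the_equality) (auto intro: is_threshold_unique)
qed

lemma stopping_domain_no_exit:
  assumes ind: "indep_vars (\<lambda>_. borel) X {1..n}" and j: "j \<in> {1..<n}"
    and dom: "(j, running_min X j \<omega>) \<in> stopping_domain M X n"
  shows "(Suc j, running_min X (Suc j) \<omega>) \<in> stopping_domain M X n"
proof -
  have X: "\<And>i. i \<in> {1..n} \<Longrightarrow> X i \<in> borel_measurable M"
    using ind by (auto simp: indep_vars_def2)
  have le: "running_min X (Suc j) \<omega> \<le> running_min X j \<omega>"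
    unfolding running_min_def using j by (intro Min_antimono) auto
  have "cont_value M X n (Suc j) (running_min X (Suc j) \<omega>)
      \<le> cont_value M X n (Suc j) (running_min X j \<omega>)"
    using j le by (intro cont_value_mono X) auto
  also have "\<dots> \<le> stop_value M X n (Suc j) (running_min X j \<omega>)"
    using dom j by (intro stopping_domain_Suc ind) (auto simp: stopping_domain_def)
  also have "\<dots> \<le> stop_value M X n (Suc j) (running_min X (Suc j) \<omega>)"
    using le by (intro stop_value_antimono X) auto
  finally show ?thesis
    using j by (simp add: stopping_domain_def)
qed

end

theorem proposition1:
  fixes M :: "'a measure" and X :: "nat \<Rightarrow> 'a \<Rightarrow> real" and n :: nat
  assumes "prob_space M"
    and "n \<ge> 1"
    and "prob_space.indep_vars M (\<lambda>_. borel) X {1..n}"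
  shows "(\<forall>j\<in>{1..<n}. threshold M X n j \<le> threshold M X n (Suc j))
    \<and> threshold M X n n = \<infinity>
    \<and> (\<forall>\<omega>\<in>space M. \<forall>j\<in>{1..<n}.
          (j, running_min X j \<omega>) \<in> stopping_domain M X n \<longrightarrow>
          (Suc j, running_min X (Suc j) \<omega>) \<in> stopping_domain M X n)"
proof -
  interpret prob_space M by fact
  show ?thesis
    using threshold_mono_Suc[OF assms(3)] threshold_last stopping_domain_no_exit[OF assms(3)]
    by auto
qed

end
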